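(* Let $t\ge 2$, $p\ge 2$ be integers, let $G=K_{p,\ldots,p}$ be the complete $t$-partite graph with all parts of size $p$, and put $d=p(t-1)$. The following hold. (1) For the adjacency weight $\phi(x,y)=1$, the arithmetic–geometric weight $\phi(x,y)=\frac{x+y}{2\sqrt{xy}}$, the geometric–arithmetic weight $\phi(x,y)=\frac{2\sqrt{xy}}{x+y}$, the first Zagreb weight $\phi(x,y)=x+y$ and the second Zagreb weight $\phi(x,y)=xy$, the spectrum of $\dot A(G)$ is always integral. (2) For the ISI weight $\phi(x,y)=\frac{xy}{x+y}$, the spectrum is integral if and only if $d$ is even, equivalently, if and only if $p$ is even or $t$ is odd. (3) For the Randić weight $\phi(x,y)=\frac{1}{\sqrt{xy}}$, the spectrum is integral if and only if $t=2$. (4) For the atom–bond connectivity weight $\phi(x,y)=\sqrt{\frac{x+y-2}{xy}}$, the spectrum is integral if and only if $t=2$ and $p=2m^2+1$ for some positive integer $m$. (5) For the Sombor weight $\phi(x,y)=\sqrt{x^2+y^2}$ and the modified Sombor weight $\phi(x,y)=\frac{1}{\sqrt{x^2+y^2}}$, the spectrum is never integral.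
   Context: For a symmetric weight function $\phi$ and a finite simple graph $G$ with vertices $v_1,\dots,v_n$ of degrees $d_1,\dots,d_n$, the degree-based weighted adjacency matrix $\dot A(G)$ is the $n\times n$ real symmetric matrix whose $(i,j)$ entry is $\phi(d_i,d_j)$ if $v_i$ and $v_j$ are adjacent, and $0$ otherwise. Its spectrum is called integral if all eigenvalues of $\dot A(G)$ are integers. *)

theory Defs
  imports
    "HOL-Library.Disjoint_Sets"
    "Graph_Theory.Digraph"
    "Jordan_Normal_Form.Spectral_Radius"
begin

text \<open>
  A finite simple graph is a \<open>pre_digraph\<close> satisfying the locale predicate \<open>graph\<close>, that is, a
  finite symmetric digraph without loops and without parallel arcs. Every edge is a pair of
  opposite arcs, so the degree of a vertex is its \<open>out_degree\<close>.
\<close>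

text \<open>
  \<open>vs\<close> is the enumeration \<open>v\<^sub>1, \<dots>, v\<^sub>n\<close> of the vertices; it is meant to be a
  distinct list whose set is \<open>verts G\<close>.
\<close>

definition weighted_adj_mat ::
    "(real \<Rightarrow> real \<Rightarrow> real) \<Rightarrow> ('a, 'b) pre_digraph \<Rightarrow> 'a list \<Rightarrow> real mat" where
  "weighted_adj_mat \<phi> G vs = mat (length vs) (length vs)
     (\<lambda>(i, j). if vs ! i \<rightarrow>\<^bsub>G\<^esub> vs ! j
               then \<phi> (real (out_degree G (vs ! i))) (real (out_degree G (vs ! j)))
               else 0)"

text \<open>
  The eigenvalues are taken over the complex numbers, so that all of them are covered without
  appeal to the symmetry of the matrix.
\<close>

definition integral_spectrum :: "real mat \<Rightarrow> bool" where
  "integral_spectrum A \<longleftrightarrow> spectrum (map_mat complex_of_real A) \<subseteq> \<int>"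

definition complete_multipartite_digraph :: "nat \<Rightarrow> nat \<Rightarrow> ('a, 'b) pre_digraph \<Rightarrow> bool" where
  "complete_multipartite_digraph t p G \<longleftrightarrow> graph G \<and>
     (\<exists>P. partition_on (verts G) P \<and> card P = t \<and> (\<forall>U\<in>P. card U = p) \<and>
          arcs_ends G = {(u, v). \<exists>U\<in>P. \<exists>V\<in>P. U \<noteq> V \<and> u \<in> U \<and> v \<in> V})"

definition adjacency_weight :: "real \<Rightarrow> real \<Rightarrow> real" where
  "adjacency_weight x y = 1"

definition arithmetic_geometric_weight :: "real \<Rightarrow> real \<Rightarrow> real" where
  "arithmetic_geometric_weight x y = (x + y) / (2 * sqrt (x * y))"

definition geometric_arithmetic_weight :: "real \<Rightarrow> real \<Rightarrow> real" where
  "geometric_arithmetic_weight x y = 2 * sqrt (x * y) / (x + y)"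

definition first_zagreb_weight :: "real \<Rightarrow> real \<Rightarrow> real" where
  "first_zagreb_weight x y = x + y"

definition second_zagreb_weight :: "real \<Rightarrow> real \<Rightarrow> real" where
  "second_zagreb_weight x y = x * y"

definition isi_weight :: "real \<Rightarrow> real \<Rightarrow> real" where
  "isi_weight x y = x * y / (x + y)"

definition randic_weight :: "real \<Rightarrow> real \<Rightarrow> real" where
  "randic_weight x y = 1 / sqrt (x * y)"

definition abc_weight :: "real \<Rightarrow> real \<Rightarrow> real" where
  "abc_weight x y = sqrt ((x + y - 2) / (x * y))"

definition sombor_weight :: "real \<Rightarrow> real \<Rightarrow> real" where
  "sombor_weight x y = sqrt (x\<^sup>2 + y\<^sup>2)"

definition modified_sombor_weight :: "real \<Rightarrow> real \<Rightarrow> real" where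
  "modified_sombor_weight x y = 1 / sqrt (x\<^sup>2 + y\<^sup>2)"

lemma transpose_weighted_adj_mat:
  assumes "graph G" and sym: "\<And>x y. \<phi> x y = \<phi> y x"
  shows "transpose_mat (weighted_adj_mat \<phi> G vs) = weighted_adj_mat \<phi> G vs"
proof -
  have "symmetric G"
    using assms(1) by (simp add: graph_def pseudo_graph_def sym_digraph_def sym_digraph_axioms_def)
  then have *: "u \<rightarrow>\<^bsub>G\<^esub> v \<longleftrightarrow> v \<rightarrow>\<^bsub>G\<^esub> u" for u v
    unfolding symmetric_def sym_def by blast
  show ?thesis
  proof (rule eq_matI)
    fix i j
    assume "i < dim_row (weighted_adj_mat \<phi> G vs)" "j < dim_col (weighted_adj_mat \<phi> G vs)"
    then show "transpose_mat (weighted_adj_mat \<phi> G vs) $$ (i, j) = weighted_adj_mat \<phi> G vs $$ (i, j)"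
      using *[of "vs ! i" "vs ! j"] sym[of "real (out_degree G (vs ! i))"]
      by (simp add: weighted_adj_mat_def)
  qed (simp_all add: weighted_adj_mat_def)
qed

lemma complete_multipartite_digraph_exists:
  assumes "p > 0"
  shows "\<exists>G :: (nat \<times> nat, (nat \<times> nat) \<times> (nat \<times> nat)) pre_digraph.
           complete_multipartite_digraph t p G"
proof -
  define V where "V = {..<t} \<times> {..<p}"
  define E where "E = {(u, v). u \<in> V \<and> v \<in> V \<and> fst u \<noteq> fst v}"
  define G where "G = \<lparr>verts = V, arcs = E, tail = fst, head = snd\<rparr>"
  define B where "B = (\<lambda>i::nat. {i} \<times> {..<p})"
  have ends: "arcs_ends G = E"
    by (simp add: arcs_ends_conv G_def)
  have "finite V" by (simp add: V_def)
  moreover have "E \<subseteq> V \<times> V" by (auto simp: E_def)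
  ultimately have fin: "finite V" "finite E"
    by (auto intro: finite_subset)
  have "symmetric G"
    unfolding symmetric_def ends by (simp add: sym_def E_def)
  then have "graph G"
    using fin by unfold_locales (auto simp: G_def E_def arc_to_ends_def)
  moreover have "partition_on V (B ` {..<t})"
  proof (rule partition_onI)
    show "{} \<notin> B ` {..<t}"
    proof
      assume "{} \<in> B ` {..<t}"
      then obtain i where "B i = {}" by auto
      moreover have "(i, 0) \<in> B i" using assms by (simp add: B_def)
      ultimately show False by simp
    qed
  qed (auto simp: V_def B_def disjnt_def)
  moreover have "inj_on B {..<t}"
  proof (rule inj_onI)
    fix i j assume "B i = B j"
    moreover have "(i, 0) \<in> B i" using assms by (simp add: B_def)
    ultimately show "i = j" by (simp add: B_def)
  qed
  then have "card (B ` {..<t}) = t" by (simp add: card_image)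
  moreover have "\<forall>U\<in>B ` {..<t}. card U = p" by (simp add: B_def card_cartesian_product)
  moreover have "E = {(u, v). \<exists>U\<in>B ` {..<t}. \<exists>W\<in>B ` {..<t}. U \<noteq> W \<and> u \<in> U \<and> v \<in> W}" (is "E = ?R")
  proof -
    have R: "((i, a), (j, b)) \<in> ?R \<longleftrightarrow> i < t \<and> j < t \<and> a < p \<and> b < p \<and> B i \<noteq> B j"
      for i a j b
      by (auto simp: B_def)
    have ER: "((i, a), (j, b)) \<in> E \<longleftrightarrow> ((i, a), (j, b)) \<in> ?R" for i a j b
      unfolding R using inj_on_eq_iff[OF \<open>inj_on B {..<t}\<close>, of i j]
      by (auto simp: E_def V_def)
    show ?thesis
    proof (rule Set.set_eqI)
      fix x :: "(nat \<times> nat) \<times> (nat \<times> nat)"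
      obtain i a j b where x: "x = ((i, a), (j, b))"
        by (cases x, cases "fst x", cases "snd x") simp
      show "x \<in> E \<longleftrightarrow> x \<in> ?R"
        unfolding x by (rule ER)
    qed
  qed
  moreover have "verts G = V" by (simp add: G_def)
  ultimately have "complete_multipartite_digraph t p G"
    unfolding complete_multipartite_digraph_def ends
    by (intro conjI exI[where x = "B ` {..<t}"]) simp_all
  then show ?thesis ..
qed

end

theory Submission
  imports Defs
begin

text \<open>
  The graph is regular of degree \<open>d = p (t - 1)\<close>, so every edge carries the same weight
  \<open>c = \<phi>(d, d)\<close> and the weighted matrix is \<open>c\<close> times the ordinary adjacency matrix. The
  latter has the eigenvalues \<open>d\<close>, \<open>-p\<close> and \<open>0\<close>: a vertex sees exactly the vertices outside its
  own part, so an eigenfunction for a nonzero eigenvalue is constant on each part, and what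
  remains is the spectrum of \<open>p\<close> times the adjacency matrix of the complete graph on the \<open>t\<close>
  parts (lemma \<open>spectrum_complete_multipartite\<close>). Hence the spectrum is integral iff both
  \<open>c d\<close> and \<open>c p\<close> are integers (lemma \<open>integral_spectrum_complete_multipartite_iff\<close>).

  The rest is arithmetic on these two numbers. The weights of the first part take integer
  values \<open>1\<close>, \<open>2 d\<close>, \<open>d\<^sup>2\<close> at \<open>(d, d)\<close>. For the ISI weight \<open>c = d / 2\<close>, and \<open>d\<^sup>2 / 2\<close> is an
  integer iff \<open>d\<close> is even. For the Randic weight \<open>c d = 1\<close> and \<open>c p = 1 / (t - 1)\<close>. For the
  two Sombor weights \<open>c d\<close> is a nonzero rational multiple of the irrational \<open>sqrt 2\<close>.

  The atom-bond connectivity weight is the only one that needs an idea. Here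
  \<open>c d = sqrt (2 d - 2)\<close>, which is an integer iff \<open>d = 2 m\<^sup>2 + 1\<close> for some \<open>m\<close>, and then
  \<open>c p = 2 m / (t - 1)\<close>. If this is an integer as well, \<open>t - 1\<close> divides \<open>2 m\<^sup>2\<close>; but it also
  divides \<open>d = 2 m\<^sup>2 + 1\<close>, so \<open>t - 1 = 1\<close> (lemma \<open>integral_abc_iff\<close>).
\<close>

section \<open>Eigenfunctions of a weighted adjacency matrix\<close>

text \<open>
  Vectors indexed by the positions of the list of vertices are traded for functions on the
  vertices, which makes the eigenvalue equation independent of the enumeration.
\<close>

lemma eigenvalue_weighted_adj_mat_iff:
  assumes "distinct vs"
  shows "eigenvalue (map_mat complex_of_real (weighted_adj_mat \<phi> G vs)) k \<longleftrightarrow>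
    (\<exists>f. (\<exists>u\<in>set vs. f u \<noteq> 0) \<and>
      (\<forall>u\<in>set vs. (\<Sum>w | w \<in> set vs \<and> u \<rightarrow>\<^bsub>G\<^esub> w.
          complex_of_real (\<phi> (real (out_degree G u)) (real (out_degree G w))) * f w) = k * f u))"
    (is "eigenvalue ?A k \<longleftrightarrow> (\<exists>f. ?nz f \<and> (\<forall>u\<in>set vs. ?S f u = k * f u))")
proof -
  let ?n = "length vs"
  let ?vec = "\<lambda>f. vec ?n (\<lambda>j. f (vs ! j))"
  have dim: "dim_row ?A = ?n" "dim_col ?A = ?n"
    by (simp_all add: weighted_adj_mat_def)
  have bij: "bij_betw ((!) vs) {..<?n} (set vs)"
    using assms by (simp add: bij_betw_nth)
  have row: "(?A *\<^sub>v ?vec f) $ i = ?S f (vs ! i)" if "i < ?n" for f i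
  proof -
    let ?g = "\<lambda>w. (if vs ! i \<rightarrow>\<^bsub>G\<^esub> w
      then complex_of_real (\<phi> (real (out_degree G (vs ! i))) (real (out_degree G w))) * f w else 0)"
    have "(?A *\<^sub>v ?vec f) $ i = (\<Sum>j<?n. ?g (vs ! j))"
      using that
      by (auto simp: weighted_adj_mat_def scalar_prod_def lessThan_atLeast0 intro!: sum.cong)
    also have "\<dots> = (\<Sum>w\<in>set vs. ?g w)"
      using bij by (rule sum.reindex_bij_betw)
    also have "\<dots> = ?S f (vs ! i)"
      by (rule sum.inter_filter[symmetric]) simp
    finally show ?thesis .
  qed
  have "eigenvector ?A (?vec f) k \<longleftrightarrow> ?nz f \<and> (\<forall>u\<in>set vs. ?S f u = k * f u)" for f
  proof -
    have "?vec f \<noteq> 0\<^sub>v ?n \<longleftrightarrow> ?nz f"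
      by (auto simp: vec_eq_iff Bex_def in_set_conv_nth)
    moreover have "?A *\<^sub>v ?vec f = k \<cdot>\<^sub>v ?vec f \<longleftrightarrow> (\<forall>i<?n. ?S f (vs ! i) = k * f (vs ! i))"
      using row dim by (auto simp: vec_eq_iff simp del: index_mult_mat_vec)
    moreover have "(\<forall>i<?n. ?S f (vs ! i) = k * f (vs ! i)) \<longleftrightarrow> (\<forall>u\<in>set vs. ?S f u = k * f u)"
      by (simp add: all_set_conv_all_nth)
    ultimately show ?thesis
      unfolding eigenvector_def dim by simp
  qed
  moreover have "\<exists>f. v = ?vec f" if "eigenvector ?A v k" for v :: "complex vec"
  proof
    from that have "v \<in> carrier_vec ?n"
      by (simp only: eigenvector_def dim)
    then show "v = ?vec (\<lambda>u. v $ inv_into {..<?n} ((!) vs) u)"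
      using bij by (auto simp: vec_eq_iff bij_betw_def inv_into_f_f)
  qed
  ultimately show ?thesis
    unfolding eigenvalue_def by blast
qed

section \<open>The spectrum of a complete multipartite graph with equal parts\<close>

lemma complete_multipartite_digraphE:
  assumes "complete_multipartite_digraph t p G"
  obtains P where "partition_on (verts G) P" "finite (verts G)" "card P = t"
    "\<And>U. U \<in> P \<Longrightarrow> card U = p"
    "\<And>U u w. U \<in> P \<Longrightarrow> u \<in> U \<Longrightarrow> u \<rightarrow>\<^bsub>G\<^esub> w \<longleftrightarrow> w \<in> verts G - U"
proof -
  from assms obtain P where P: "partition_on (verts G) P" "card P = t" "\<forall>U\<in>P. card U = p"
    and ends: "arcs_ends G = {(u, v). \<exists>U\<in>P. \<exists>V\<in>P. U \<noteq> V \<and> u \<in> U \<and> v \<in> V}"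
    and "graph G"
    unfolding complete_multipartite_digraph_def by (elim conjE exE) (rule that)
  interpret graph G by fact
  have uniq: "U = V" if "U \<in> P" "V \<in> P" "x \<in> U" "x \<in> V" for U V x
    using partition_onD2[OF P(1)] that by (auto simp: disjoint_def)
  have union: "\<Union>P = verts G"
    using partition_onD1[OF P(1)] by simp
  show ?thesis
  proof (rule that[OF P(1) finite_verts P(2)])
    show "u \<rightarrow>\<^bsub>G\<^esub> w \<longleftrightarrow> w \<in> verts G - U" if "U \<in> P" "u \<in> U" for U u w
    proof
      assume "u \<rightarrow>\<^bsub>G\<^esub> w"
      then show "w \<in> verts G - U"
        unfolding ends using that union by (auto dest: uniq)
    next
      assume "w \<in> verts G - U"
      then obtain W where "W \<in> P" "w \<in> W" "W \<noteq> U"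
        using union by auto
      with that show "u \<rightarrow>\<^bsub>G\<^esub> w"
        unfolding ends by auto
    qed
  qed (use P(3) in auto)
qed

text \<open>
  The out-degree counts arcs; without parallel arcs an arc out of \<open>u\<close> is determined by its head.
\<close>

lemma (in fin_digraph) out_degree_eq_card_neighbours:
  assumes "nomulti_digraph G"
  shows "out_degree G u = card {w. u \<rightarrow>\<^bsub>G\<^esub> w}"
proof -
  interpret nomulti_digraph G by fact
  have "inj_on (head G) (out_arcs G u)"
    by (rule inj_onI) (auto intro: no_multi_arcs simp: arc_to_ends_def)
  moreover have "head G ` out_arcs G u = {w. u \<rightarrow>\<^bsub>G\<^esub> w}"
    by (auto simp: arcs_ends_conv)
  ultimately show ?thesis
    unfolding out_degree_def using card_image by fastforce
qed

lemma out_degree_complete_multipartite: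
  assumes G: "complete_multipartite_digraph t p G" and "u \<in> verts G"
  shows "out_degree G u = p * (t - 1)"
proof -
  from G have "graph G"
    by (simp add: complete_multipartite_digraph_def)
  then interpret graph G .
  from G obtain P where P: "partition_on (verts G) P" "card P = t"
    "\<And>U. U \<in> P \<Longrightarrow> card U = p"
    "\<And>U u w. U \<in> P \<Longrightarrow> u \<in> U \<Longrightarrow> u \<rightarrow>\<^bsub>G\<^esub> w \<longleftrightarrow> w \<in> verts G - U"
    by (rule complete_multipartite_digraphE) blast
  have union: "\<Union>P = verts G"
    using partition_onD1[OF P(1)] by simp
  then obtain U where U: "U \<in> P" "u \<in> U"
    using assms(2) by blast
  have "U \<subseteq> verts G"
    using U union by blast
  have "card (verts G) = card P * p"
    using product_partition[OF P(1)] P(3) finite_verts union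
    by (metis Union_upper finite_subset sum_constant sum.cong of_nat_id)
  then have "card (verts G - U) = p * (t - 1)"
    using P(2) P(3)[OF U(1)] \<open>U \<subseteq> verts G\<close>
    by (simp add: card_Diff_subset finite_subset[OF _ finite_verts] diff_mult_distrib2 mult.commute)
  moreover have "{w. u \<rightarrow>\<^bsub>G\<^esub> w} = verts G - U"
    using P(4)[OF U] by auto
  ultimately show ?thesis
    using out_degree_eq_card_neighbours[OF nomulti_digraph] by simp
qed

text \<open>
  Eigenfunctions for the three values are, in the order of the right-hand side, the difference
  of the indicators of two vertices in one part (whence \<open>p \<ge> 2\<close>), the constant function, and the
  difference of the indicators of two parts. Conversely, let \<open>f\<close> be an eigenfunction for \<open>k\<close> and
  write \<open>S\<close> and \<open>s\<^sub>W\<close> for its sums over all vertices and over the part \<open>W\<close>, so that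
  \<open>c (S - s\<^sub>W) = k f(w)\<close> for \<open>w\<close> in \<open>W\<close>. Summing over \<open>W\<close> gives \<open>(k + c p) s\<^sub>W = c p S\<close>, and
  summing this over all parts gives \<open>(k - c d) S = 0\<close>. If \<open>k\<close> is none of the three values, then
  \<open>S = 0\<close>, every \<open>s\<^sub>W\<close> is zero and \<open>f\<close> vanishes.
\<close>

lemma spectrum_complete_multipartite:
  assumes t: "t \<ge> 2" and p: "p \<ge> 2"
    and G: "complete_multipartite_digraph t p G"
    and vs: "distinct vs" "set vs = verts G"
    and d: "d = p * (t - 1)" and c: "c = \<phi> (real d) (real d)"
  shows "spectrum (map_mat complex_of_real (weighted_adj_mat \<phi> G vs)) =
    complex_of_real ` {0, c * real d, - (c * real p)}"
proof -
  obtain P where part: "partition_on (verts G) P" and fin: "finite (verts G)" and "card P = t"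
    and card: "\<And>U. U \<in> P \<Longrightarrow> card U = p"
    and adj: "\<And>U u w. U \<in> P \<Longrightarrow> u \<in> U \<Longrightarrow> u \<rightarrow>\<^bsub>G\<^esub> w \<longleftrightarrow> w \<in> verts G - U"
    using complete_multipartite_digraphE[OF G] by blast
  have union: "\<Union>P = verts G"
    using partition_onD1[OF part] by simp
  have disj: "disjoint P"
    by (rule partition_onD2[OF part])
  have finU: "finite U" if "U \<in> P" for U
    using that union fin by (metis Union_upper finite_subset)
  have sub: "U \<subseteq> verts G" if "U \<in> P" for U
    using that union by blast
  have sum_parts: "(\<Sum>w\<in>verts G. f w) = (\<Sum>U\<in>P. \<Sum>w\<in>U. f w)" for f :: "'a \<Rightarrow> complex"
    unfolding union[symmetric] using sum.Union_disjoint_sets[OF _ disj] finU by (simp add: comp_def)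
  \<comment> \<open>the eigenvalue equation with the sum over the neighbours of \<open>u\<close> rewritten as the sum over
    all vertices minus the sum over the part of \<open>u\<close>\<close>
  define is_eigfun where "is_eigfun k f \<longleftrightarrow> (\<exists>u\<in>verts G. f u \<noteq> 0) \<and>
      (\<forall>U\<in>P. \<forall>u\<in>U. complex_of_real c * ((\<Sum>w\<in>verts G. f w) - (\<Sum>w\<in>U. f w)) = k * f u)" for k f
  have eig: "eigenvalue (map_mat complex_of_real (weighted_adj_mat \<phi> G vs)) k \<longleftrightarrow>
      (\<exists>f. is_eigfun k f)" for k
  proof -
    have "(\<Sum>w | w \<in> verts G \<and> u \<rightarrow>\<^bsub>G\<^esub> w.
          complex_of_real (\<phi> (real (out_degree G u)) (real (out_degree G w))) * f w) =
        complex_of_real c * ((\<Sum>w\<in>verts G. f w) - (\<Sum>w\<in>U. f w))"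
      if "U \<in> P" "u \<in> U" for U u f
    proof -
      have "{w. w \<in> verts G \<and> u \<rightarrow>\<^bsub>G\<^esub> w} = verts G - U"
        using adj[OF that] by auto
      moreover have "u \<in> verts G"
        using that sub by blast
      ultimately show ?thesis
        using sum_diff[OF fin sub[OF that(1)], of f]
        by (simp add: out_degree_complete_multipartite[OF G] c d flip: sum_distrib_left)
    qed
    then show ?thesis
      unfolding eigenvalue_weighted_adj_mat_iff[OF vs(1)] vs(2) is_eigfun_def union[symmetric]
      by (auto intro!: ex_cong1)
  qed
  have real_d: "complex_of_nat d = of_nat t * of_nat p - of_nat p"
    using t by (simp add: d of_nat_diff algebra_simps)
  have "finite P" "card P > 1"
    using \<open>card P = t\<close> t by (auto intro: card_ge_0_finite)
  then obtain U V where UV: "U \<in> P" "V \<in> P" "U \<noteq> V"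
    using card_le_Suc0_iff_eq[of P] by force
  have "\<exists>a\<in>U. \<exists>b\<in>U. a \<noteq> b"
    using card_le_Suc0_iff_eq[OF finU[OF UV(1)]] card[OF UV(1)] p by auto
  then obtain a b where ab: "a \<in> U" "b \<in> U" "a \<noteq> b"
    by blast
  have not_U: "x \<notin> U" if "x \<in> W" "W \<in> P" "W \<noteq> U" for x W
    using disj UV(1) that by (auto simp: disjoint_def)
  have not_V: "x \<notin> V" if "x \<in> W" "W \<in> P" "W \<noteq> V" for x W
    using disj UV(2) that by (auto simp: disjoint_def)

  have "is_eigfun (of_real (c * real d)) (\<lambda>_. 1)"
  proof -
    have "complex_of_nat (card (verts G)) = of_nat t * of_nat p"
      using sum_parts[of "\<lambda>_. 1"] card \<open>card P = t\<close> by simp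
    then show ?thesis
      unfolding is_eigfun_def using ab(1) sub[OF UV(1)] card by (auto simp: real_d)
  qed
  moreover have "is_eigfun (of_real (- (c * real p))) (\<lambda>x. of_bool (x \<in> U) - of_bool (x \<in> V))"
  proof -
    let ?f = "\<lambda>x. of_bool (x \<in> U) - of_bool (x \<in> V) :: complex"
    have s: "(\<Sum>w\<in>W. ?f w) = of_nat p * (of_bool (W = U) - of_bool (W = V))" if "W \<in> P" for W
    proof -
      have "?f w = of_bool (W = U) - of_bool (W = V)" if "w \<in> W" for w
        using that \<open>W \<in> P\<close> not_U not_V by auto
      then show ?thesis
        using card[OF that] by simp
    qed
    then have "(\<Sum>w\<in>verts G. ?f w) = of_nat p * (\<Sum>W\<in>P. of_bool (W = U) - of_bool (W = V))"
      by (simp add: sum_parts sum_distrib_left)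
    also have "\<dots> = 0"
      using UV \<open>finite P\<close> by (simp add: sum_subtractf of_bool_def)
    finally show ?thesis
      unfolding is_eigfun_def using s ab(1) sub[OF UV(1)] not_V[OF _ UV(1) UV(3)] not_U not_V
      by (fastforce simp: of_bool_def)
  qed
  moreover have "is_eigfun 0 (\<lambda>x. of_bool (x = a) - of_bool (x = b))"
  proof -
    let ?f = "\<lambda>x. of_bool (x = a) - of_bool (x = b) :: complex"
    have s: "(\<Sum>w\<in>W. ?f w) = 0" if "W \<in> P" for W
      using ab not_U[OF _ that] finU[OF that]
      by (cases "W = U") (auto simp: sum_subtractf of_bool_def)
    then show ?thesis
      unfolding is_eigfun_def using ab sub[OF UV(1)] by (auto simp: sum_parts)
  qed
  moreover have "k = 0 \<or> k = of_real (c * real d) \<or> k = of_real (- (c * real p))"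
    if "is_eigfun k f" for k f
  proof (rule ccontr)
    assume neg: "\<not> ?thesis"
    define S where "S = (\<Sum>w\<in>verts G. f w)"
    define s where "s W = (\<Sum>w\<in>W. f w)" for W
    have eq: "complex_of_real c * (S - s W) = k * f w" if "W \<in> P" "w \<in> W" for W w
      using \<open>is_eigfun k f\<close> that by (auto simp: is_eigfun_def S_def s_def)
    have part_eq: "(k + of_real c * of_nat p) * s W = of_real c * of_nat p * S" if "W \<in> P" for W
    proof -
      have "k * s W = (\<Sum>w\<in>W. of_real c * (S - s W))"
        unfolding s_def sum_distrib_left using eq[OF that, unfolded s_def] by (intro sum.cong) auto
      then show ?thesis
        using card[OF that] by (simp add: algebra_simps)
    qed
    have "(k + of_real c * of_nat p) * S = (\<Sum>W\<in>P. (k + of_real c * of_nat p) * s W)"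
      unfolding S_def s_def sum_parts by (simp add: sum_distrib_left)
    also have "\<dots> = of_nat t * (of_real c * of_nat p * S)"
      using part_eq \<open>card P = t\<close> by simp
    finally have "(k - of_real c * of_nat d) * S = 0"
      by (simp add: real_d algebra_simps)
    then have "S = 0"
      using neg by auto
    moreover have "s W = 0" if "W \<in> P" for W
      using part_eq[OF that] \<open>S = 0\<close> neg by (auto simp: add_eq_0_iff2)
    ultimately have "f w = 0" if "w \<in> verts G" for w
      using eq neg that union by force
    then show False
      using \<open>is_eigfun k f\<close> by (auto simp: is_eigfun_def)
  qed
  ultimately show ?thesis
    unfolding spectrum_def eig by auto
qed

lemma integral_spectrum_complete_multipartite_iff:
  assumes "t \<ge> 2" "p \<ge> 2" "complete_multipartite_digraph t p G"
    and "distinct vs" "set vs = verts G" and "d = p * (t - 1)"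
  shows "integral_spectrum (weighted_adj_mat \<phi> G vs) \<longleftrightarrow>
    \<phi> (real d) (real d) * real d \<in> \<int> \<and> \<phi> (real d) (real d) * real p \<in> \<int>"
  unfolding integral_spectrum_def spectrum_complete_multipartite[OF assms refl]
  by (simp del: of_real_mult of_real_minus)

section \<open>Integrality of quotients and square roots\<close>

text \<open>If \<open>sqrt 2 = m / n\<close> in lowest terms, then \<open>2 n\<^sup>2 = m\<^sup>2\<close> makes first \<open>m\<close>, then \<open>n\<close> even.\<close>

lemma sqrt_2_irrational: "sqrt 2 \<notin> \<rat>"
proof
  assume "sqrt 2 \<in> \<rat>"
  then obtain m n :: nat where "n \<noteq> 0" and mn: "\<bar>sqrt 2\<bar> = real m / real n" and "coprime m n"
    by (rule Rats_abs_nat_div_natE)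
  from mn \<open>n \<noteq> 0\<close> have "sqrt 2 * real n = real m"
    by (simp add: field_simps)
  then have "(sqrt 2 * real n)\<^sup>2 = (real m)\<^sup>2"
    by simp
  then have "real (2 * n\<^sup>2) = real (m\<^sup>2)"
    by (simp add: power_mult_distrib)
  then have sq: "2 * n\<^sup>2 = m\<^sup>2"
    by (simp only: of_nat_eq_iff)
  then have "even m"
    by (metis dvd_triv_left even_power)
  then obtain j where "m = 2 * j" ..
  with sq have "n\<^sup>2 = 2 * j\<^sup>2"
    by (simp add: power2_eq_square)
  then have "even n"
    by (metis dvd_triv_left even_power)
  with \<open>even m\<close> \<open>coprime m n\<close> show False
    by (auto simp: coprime_def)
qed

lemma divide_nat_in_Ints_iff:
  assumes "b > 0"
  shows "real a / real b \<in> \<int> \<longleftrightarrow> b dvd a"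
  using of_int_div_of_int_in_Ints_iff[where 'a = real, of "int a" "int b"] assms by simp

lemma sqrt_nat_in_Ints_iff: "sqrt (real n) \<in> \<int> \<longleftrightarrow> (\<exists>k. n = k\<^sup>2)"
proof
  assume "sqrt (real n) \<in> \<int>"
  then have "sqrt (real n) \<in> \<nat>"
    by (simp add: Nats_altdef2)
  then obtain k where "sqrt (real n) = real k"
    by (auto elim: Nats_cases)
  then have "real n = real (k\<^sup>2)"
    by (metis of_nat_0_le_iff of_nat_power real_sqrt_pow2)
  then show "\<exists>k. n = k\<^sup>2"
    by (auto simp only: of_nat_eq_iff)
qed auto

text \<open>
  The two numbers are the nonzero eigenvalues for the atom-bond connectivity weight, up to sign.
  If \<open>2 d - 2\<close> is a square, it is \<open>(2 m)\<^sup>2\<close> by parity, so \<open>d = 2 m\<^sup>2 + 1\<close>. The second number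
  makes \<open>t - 1\<close> a divisor of \<open>2 m\<close>, hence of \<open>d - 1\<close>, whereas it divides \<open>d\<close> by definition.
\<close>

lemma integral_abc_iff:
  assumes t: "t \<ge> 2" and p: "p \<ge> 2" and d: "d = p * (t - 1)"
  shows "sqrt (2 * real d - 2) \<in> \<int> \<and> sqrt (2 * real d - 2) / real (t - 1) \<in> \<int> \<longleftrightarrow>
    t = 2 \<and> (\<exists>m::nat. m > 0 \<and> p = 2 * m\<^sup>2 + 1)"
    (is "?L \<longleftrightarrow> ?R")
proof
  assume ?L
  have "d \<ge> 2"
    using t p d by (metis One_nat_def Suc_1 diff_le_mono diff_Suc_1 mult_le_mono nat_mult_1_right)
  then have rad: "2 * real d - 2 = real (2 * d - 2)"
    by (simp add: of_nat_diff)
  with \<open>?L\<close> obtain k where k: "2 * d - 2 = k\<^sup>2"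
    using sqrt_nat_in_Ints_iff by metis
  then have "even (k\<^sup>2)"
    by (metis dvd_diff_nat dvd_triv_left dvd_refl)
  then obtain m where m: "k = 2 * m"
    by auto
  with k \<open>d \<ge> 2\<close> have d_m: "d = 2 * m\<^sup>2 + 1"
    by (simp add: power2_eq_square)
  have "sqrt (2 * real d - 2) = real (2 * m)"
    unfolding rad k m by (simp only: of_nat_power real_sqrt_abs abs_of_nat)
  with \<open>?L\<close> have "real (2 * m) / real (t - 1) \<in> \<int>"
    by simp
  then have "(t - 1) dvd 2 * m"
    using t by (subst (asm) divide_nat_in_Ints_iff) auto
  then have "(t - 1) dvd 2 * m\<^sup>2"
    unfolding power2_eq_square mult.assoc[symmetric] by (rule dvd_mult2)
  moreover have "(t - 1) dvd 2 * m\<^sup>2 + 1"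
    using d d_m by (metis dvd_triv_right)
  ultimately have "t - 1 = 1"
    by (metis dvd_add_right_iff nat_dvd_1_iff_1)
  then have "t = 2" "p = 2 * m\<^sup>2 + 1"
    using d d_m by auto
  moreover have "m > 0"
    using \<open>p = 2 * m\<^sup>2 + 1\<close> p by (cases m) auto
  ultimately show ?R
    by blast
next
  assume ?R
  then obtain m where "t = 2" "p = 2 * m\<^sup>2 + 1"
    by blast
  then have "sqrt (2 * real d - 2) = real (2 * m)"
    using d by (auto simp: real_sqrt_mult intro!: real_sqrt_unique)
  with \<open>t = 2\<close> show ?L
    by simp
qed

section \<open>The individual weights\<close>

theorem corollary2p14:
  fixes t p d :: nat
    and G :: "('a, 'b) pre_digraph"
    and vs :: "'a list"
  assumes "t \<ge> 2" and "p \<ge> 2"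
    and "complete_multipartite_digraph t p G"
    and "distinct vs" and "set vs = verts G"
    and "d = p * (t - 1)"
  shows
    "(integral_spectrum (weighted_adj_mat adjacency_weight G vs) \<and>
      integral_spectrum (weighted_adj_mat arithmetic_geometric_weight G vs) \<and>
      integral_spectrum (weighted_adj_mat geometric_arithmetic_weight G vs) \<and>
      integral_spectrum (weighted_adj_mat first_zagreb_weight G vs) \<and>
      integral_spectrum (weighted_adj_mat second_zagreb_weight G vs)) \<and>
     ((integral_spectrum (weighted_adj_mat isi_weight G vs) \<longleftrightarrow> even d) \<and>
      (integral_spectrum (weighted_adj_mat isi_weight G vs) \<longleftrightarrow> even p \<or> odd t)) \<and>
     (integral_spectrum (weighted_adj_mat randic_weight G vs) \<longleftrightarrow> t = 2) \<and>
     (integral_spectrum (weighted_adj_mat abc_weight G vs) \<longleftrightarrow>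
        t = 2 \<and> (\<exists>m::nat. m > 0 \<and> p = 2 * m\<^sup>2 + 1)) \<and>
     (\<not> integral_spectrum (weighted_adj_mat sombor_weight G vs) \<and>
      \<not> integral_spectrum (weighted_adj_mat modified_sombor_weight G vs))"
proof -
  note int_iff = integral_spectrum_complete_multipartite_iff[OF assms]
  define x where "x = real d"
  have "d > 0"
    using assms(1,2,6) by simp
  then have x: "x > 0"
    by (simp add: x_def)
  have x_Ints: "x \<in> \<int>"
    by (simp add: x_def)
  have ratio: "real p / x = 1 / real (t - 1)"
    using assms(1,2) by (simp add: x_def assms(6))
  have simple: "adjacency_weight x x = 1" "arithmetic_geometric_weight x x = 1"
    "geometric_arithmetic_weight x x = 1" "first_zagreb_weight x x = 2 * x"
    "second_zagreb_weight x x = x * x"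
    using x by (simp_all add: adjacency_weight_def arithmetic_geometric_weight_def
        geometric_arithmetic_weight_def first_zagreb_weight_def second_zagreb_weight_def)
  have isi: "isi_weight x x = x / 2"
    using x by (simp add: isi_weight_def)
  have randic: "randic_weight x x * x = 1" "randic_weight x x * real p = 1 / real (t - 1)"
    unfolding ratio[symmetric] using x by (simp_all add: randic_weight_def)
  have abc_xx: "abc_weight x x = sqrt (2 * x - 2) / x"
    using x by (simp add: abc_weight_def real_sqrt_divide)
  have abc: "abc_weight x x * x = sqrt (2 * x - 2)"
    "abc_weight x x * real p = sqrt (2 * x - 2) / real (t - 1)"
    using x arg_cong[OF ratio, of "\<lambda>r. sqrt (2 * x - 2) * r"] by (simp_all add: abc_xx)
  have diag: "sqrt (x\<^sup>2 + x\<^sup>2) = sqrt 2 * x"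
    using x by (simp add: real_sqrt_mult flip: mult_2)

  have part1: "integral_spectrum (weighted_adj_mat adjacency_weight G vs) \<and>
      integral_spectrum (weighted_adj_mat arithmetic_geometric_weight G vs) \<and>
      integral_spectrum (weighted_adj_mat geometric_arithmetic_weight G vs) \<and>
      integral_spectrum (weighted_adj_mat first_zagreb_weight G vs) \<and>
      integral_spectrum (weighted_adj_mat second_zagreb_weight G vs)"
    using x_Ints unfolding int_iff x_def[symmetric] simple by simp

  \<comment> \<open>the two nonzero eigenvalues are \<open>d\<^sup>2 / 2\<close> and \<open>-d p / 2\<close>; the first already forces \<open>d\<close> to
    be even\<close>
  have half: "real n / 2 \<in> \<int> \<longleftrightarrow> even n" for n
    using divide_nat_in_Ints_iff[of 2 n] by simp
  have "integral_spectrum (weighted_adj_mat isi_weight G vs) \<longleftrightarrow>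
      real (d * d) / 2 \<in> \<int> \<and> real (d * p) / 2 \<in> \<int>"
    unfolding int_iff x_def[symmetric] isi by (simp add: x_def)
  also have "\<dots> \<longleftrightarrow> even d"
    unfolding half by auto
  finally have part2: "integral_spectrum (weighted_adj_mat isi_weight G vs) \<longleftrightarrow> even d" .
  have even_d: "even d \<longleftrightarrow> even p \<or> odd t"
    using assms(1,6) by auto

  have "1 / real (t - 1) \<in> \<int> \<longleftrightarrow> (t - 1) dvd 1"
    using divide_nat_in_Ints_iff[of "t - 1" 1] assms(1) by simp
  then have part3: "integral_spectrum (weighted_adj_mat randic_weight G vs) \<longleftrightarrow> t = 2"
    unfolding int_iff x_def[symmetric] randic using assms(1) by auto

  have part4: "integral_spectrum (weighted_adj_mat abc_weight G vs) \<longleftrightarrow>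
      t = 2 \<and> (\<exists>m::nat. m > 0 \<and> p = 2 * m\<^sup>2 + 1)"
    unfolding int_iff x_def[symmetric] abc unfolding x_def
    by (rule integral_abc_iff[OF assms(1,2,6)])

  have "sqrt 2 \<in> \<rat>" if "sombor_weight x x * x \<in> \<int>"
  proof -
    have "sqrt 2 = sombor_weight x x * x / (x * x)"
      using x unfolding sombor_weight_def diag by simp
    also have "\<dots> \<in> \<rat>"
      by (rule Rats_divide[OF subsetD[OF Ints_subset_Rats that]])
        (simp add: x_def)
    finally show ?thesis .
  qed
  moreover have "sqrt 2 \<in> \<rat>" if "modified_sombor_weight x x * x \<in> \<int>"
  proof -
    have "sqrt 2 = 1 / (modified_sombor_weight x x * x)"
      using x unfolding modified_sombor_weight_def diag by simp
    also have "\<dots> \<in> \<rat>"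
      by (rule Rats_divide[OF _ subsetD[OF Ints_subset_Rats that]]) simp
    finally show ?thesis .
  qed
  ultimately have part5: "\<not> integral_spectrum (weighted_adj_mat sombor_weight G vs)"
    "\<not> integral_spectrum (weighted_adj_mat modified_sombor_weight G vs)"
    unfolding int_iff x_def[symmetric] using sqrt_2_irrational by blast+

  show ?thesis
    using part1 part2 even_d part3 part4 part5 by blast
qed

end
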